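(* Let $1\le k<n$, let $X_1,\dots,X_n$ be compact metric spaces, $X=X_1\times\dots\times X_n$, and let $c\ge0$ be a continuous function on $X$. For every $k$-tuple $i=(i_1,\dots,i_k)\in\mathcal{I}_k$ let $\mu_i$ be a Borel probability measure on $X_{i_1}\times\dots\times X_{i_k}$, and let $\mathcal{P}$ be the set of Borel probability measures $\pi$ on $X$ such that ${\rm Pr}_i\pi=\mu_i$ for every $i\in\mathcal{I}_k$. Assume $\mathcal{P}$ is non-empty. Then $$\min_{\pi\in\mathcal{P}}\int_X c\,d\pi=\sup\sum_{i\in\mathcal{I}_k}\int f_i(x_{i_1},\dots,x_{i_k})\,d\mu_i,$$ where the supremum is taken over all families $(f_i)_{i\in\mathcal{I}_k}$ of functions $f_i\in L_1(X_{i_1}\times\dots\times X_{i_k},\mu_i)$ satisfying $$\sum_{i\in\mathcal{I}_k}f_i(x_{i_1},\dots,x_{i_k})\le c(x_1,\dots,x_n)\quad\text{for all }(x_1,\dots,x_n)\in X.$$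
   Context: $\mathcal{I}_k$ is the set of all ordered $k$-tuples $i=(i_1,\dots,i_k)$ of indices in $\{1,\dots,n\}$ with $i_1<i_2<\dots<i_k$. ${\rm Pr}_i\pi$ denotes the push-forward of $\pi$ under the projection $X\ni x\mapsto(x_{i_1},\dots,x_{i_k})$. The functions $f_i$ are everywhere-defined, real-valued, measurable and $\mu_i$-integrable. *)

theory Defs
  imports "HOL-Probability.Probability"
begin

definition borel_of :: "'b topology \<Rightarrow> 'b measure" where
  "borel_of T = sigma (topspace T) {U. openin T U}"

definition borel_probability_measures :: "'b topology \<Rightarrow> 'b measure set" where
  "borel_probability_measures T = {M. prob_space M \<and> sets M = sets (borel_of T)}"

definition increasing_tuples :: "nat \<Rightarrow> nat \<Rightarrow> nat list set" where
  "increasing_tuples n k = {i. length i = k \<and> sorted_wrt (<) i \<and> set i \<subseteq> {1..n}}"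

text \<open>
  The metric spaces are arbitrary and may all differ; they only share the type of their points.
  A point of the full product is a function on \<open>{1..n}\<close>, undefined elsewhere.
\<close>

definition full_product :: "nat \<Rightarrow> (nat \<Rightarrow> 'a metric) \<Rightarrow> (nat \<Rightarrow> 'a) topology" where
  "full_product n X = product_topology (\<lambda>l. mtopology_of (X l)) {1..n}"

text \<open>
  A point of the partial product belonging to the tuple \<open>i\<close> is indexed by the positions in \<open>i\<close>,
  counted from 0 as usual for lists, and not by the entries of \<open>i\<close>.
\<close>

definition partial_product :: "(nat \<Rightarrow> 'a metric) \<Rightarrow> nat list \<Rightarrow> (nat \<Rightarrow> 'a) topology" where
  "partial_product X i = product_topology (\<lambda>j. mtopology_of (X (i ! j))) {..<length i}"

definition tuple_proj :: "nat list \<Rightarrow> (nat \<Rightarrow> 'a) \<Rightarrow> (nat \<Rightarrow> 'a)" where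
  "tuple_proj i x = (\<lambda>j\<in>{..<length i}. x (i ! j))"

definition push_forward ::
    "(nat \<Rightarrow> 'a metric) \<Rightarrow> nat list \<Rightarrow> (nat \<Rightarrow> 'a) measure \<Rightarrow> (nat \<Rightarrow> 'a) measure" where
  "push_forward X i \<pi> = distr \<pi> (borel_of (partial_product X i)) (tuple_proj i)"

definition transport_plans ::
    "nat \<Rightarrow> nat \<Rightarrow> (nat \<Rightarrow> 'a metric) \<Rightarrow> (nat list \<Rightarrow> (nat \<Rightarrow> 'a) measure)
      \<Rightarrow> (nat \<Rightarrow> 'a) measure set" where
  "transport_plans n k X \<mu> =
    {\<pi> \<in> borel_probability_measures (full_product n X).
      \<forall>i\<in>increasing_tuples n k. push_forward X i \<pi> = \<mu> i}"

definition dual_admissible ::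
    "nat \<Rightarrow> nat \<Rightarrow> (nat \<Rightarrow> 'a metric) \<Rightarrow> (nat list \<Rightarrow> (nat \<Rightarrow> 'a) measure)
      \<Rightarrow> ((nat \<Rightarrow> 'a) \<Rightarrow> real) \<Rightarrow> (nat list \<Rightarrow> (nat \<Rightarrow> 'a) \<Rightarrow> real) set" where
  "dual_admissible n k X \<mu> c =
    {f. (\<forall>i\<in>increasing_tuples n k. integrable (\<mu> i) (f i)) \<and>
        (\<forall>x\<in>topspace (full_product n X).
          (\<Sum>i\<in>increasing_tuples n k. f i (tuple_proj i x)) \<le> c x)}"

end

theory Submission
  imports Defs
begin

text \<open>
  Fix one plan \<open>\<pi>\<close>. On the space \<open>G\<close> of sums of continuous functions of \<open>k\<close> coordinates the
  integral against a plan does not depend on the plan. Let \<open>p h\<close> be the infimum of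
  \<open>\<integral>g \<partial>\<pi>\<close> over all \<open>g \<in> G\<close> above \<open>h\<close>. By Hahn-Banach there is a linear functional on the continuous functions,
  dominated by \<open>p\<close>, which takes at \<open>- c\<close> the value \<open>p (- c)\<close>, that is, at \<open>c\<close> the supremum of
  the dual problem over \<open>G\<close>. Domination by \<open>p\<close> makes it positive and forces it to agree with the
  integral on \<open>G\<close>, so the measure representing it (Riesz) is again a plan, and its cost is the dual value. As
  the integral of any admissible family is at most the cost of any plan, this plan is optimal.
\<close>

section \<open>Borel measures and continuous functions\<close>

lemma space_borel_of [simp]: "space (borel_of T) = topspace T"
  unfolding borel_of_def by (intro space_measure_of) (auto dest: openin_subset)

lemma sets_borel_of: "sets (borel_of T) = sigma_sets (topspace T) {U. openin T U}"
  unfolding borel_of_def by (intro sets_measure_of) (auto dest: openin_subset)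

lemma continuous_map_measurable:
  assumes "continuous_map T S f"
  shows "f \<in> borel_of T \<rightarrow>\<^sub>M borel_of S"
proof (rule measurable_sigma_sets[OF sets_borel_of])
  show "f \<in> space (borel_of T) \<rightarrow> topspace S"
    using assms by (auto simp: continuous_map_def)
  show "f -` U \<inter> space (borel_of T) \<in> sets (borel_of T)" if "U \<in> {U. openin S U}" for U
  proof -
    have "f -` U \<inter> topspace T = {x \<in> topspace T. f x \<in> U}" by auto
    moreover have "openin T {x \<in> topspace T. f x \<in> U}"
      using assms that by (auto simp: continuous_map_def)
    ultimately show ?thesis by (auto simp: sets_borel_of)
  qed
qed (auto dest: openin_subset)

lemma borel_of_euclidean: "borel_of euclidean = borel"
  by (simp add: borel_of_def borel_def)

lemma continuous_map_borel_measurable: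
  "sets M = sets (borel_of T) \<Longrightarrow> continuous_map T euclideanreal f \<Longrightarrow> f \<in> borel_measurable M"
  using continuous_map_measurable[of T euclideanreal f]
  by (simp add: borel_of_euclidean cong: measurable_cong_sets)

lemma compact_space_continuous_map_bounded:
  fixes f :: "'b \<Rightarrow> real"
  assumes "compact_space T" "continuous_map T euclideanreal f"
  shows "\<exists>B>0. \<forall>x\<in>topspace T. \<bar>f x\<bar> \<le> B"
proof -
  have "compactin euclideanreal (f ` topspace T)"
    using assms by (intro image_compactin[of T]) (simp_all add: compact_space_def)
  then have "bounded (f ` topspace T)"
    by (simp add: compact_imp_bounded)
  then show ?thesis
    by (auto simp: bounded_pos)
qed

lemma continuous_map_integrable:
  fixes f :: "'b \<Rightarrow> real"
  assumes "compact_space T" "continuous_map T euclideanreal f"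
    and "finite_measure M" "sets M = sets (borel_of T)"
  shows "integrable M f"
proof -
  interpret finite_measure M by fact
  obtain B where "\<forall>x\<in>topspace T. \<bar>f x\<bar> \<le> B"
    using compact_space_continuous_map_bounded[OF assms(1,2)] by auto
  moreover have "space M = topspace T"
    using sets_eq_imp_space_eq[OF assms(4)] by simp
  ultimately show ?thesis
    using continuous_map_borel_measurable[OF assms(4,2)]
    by (intro integrable_const_bound[where B=B]) auto
qed

text \<open>The distance to the complement of \<open>U\<close> works: it is 1-Lipschitz, and it
  vanishes only on the complement because that set is closed. It takes the place of Urysohn
  functions in what follows.\<close>

lemma metrizable_openin_eq_positive:
  assumes "metrizable_space T" "openin T U"
  obtains f :: "'b \<Rightarrow> real" where "continuous_map T euclideanreal f"
    "\<And>x. 0 \<le> f x" "U = {x \<in> topspace T. 0 < f x}"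
proof -
  obtain M d where "Metric_space M d" and T: "T = Metric_space.mtopology M d"
    using assms(1) by (auto simp: metrizable_space_def)
  then interpret Metric_space M d by simp
  define C where "C = M - U"
  show ?thesis
  proof (cases "C = {}")
    \<comment> \<open>An infimum over the empty set carries no information; \<open>U\<close> is then
      the whole space and the constant 1 serves.\<close>
    case True
    then have "U = topspace T"
      using assms(2) openin_subset T by (fastforce simp: C_def)
    then show ?thesis
      by (intro that[of "\<lambda>_. 1"]) auto
  next
    case False
    define h where "h x = (INF y\<in>C. d x y)" for x
    have bdd: "bdd_below (d x ` C)" for x
      by (rule bdd_belowI[of _ 0]) auto
    have h_nonneg: "0 \<le> h x" for x
      unfolding h_def using False by (intro cINF_greatest) auto
    have h_le: "h x \<le> d x x' + h x'" if "x \<in> M" "x' \<in> M" for x x'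
    proof -
      have "h x - d x x' \<le> d x' y" if "y \<in> C" for y
      proof -
        have "h x \<le> d x y"
          unfolding h_def using bdd that by (rule cINF_lower)
        moreover have "d x y \<le> d x x' + d x' y"
          using \<open>x \<in> M\<close> \<open>x' \<in> M\<close> that by (intro triangle) (auto simp: C_def)
        ultimately show ?thesis by simp
      qed
      then have "h x - d x x' \<le> h x'"
        unfolding h_def[of x'] using False by (intro cINF_greatest) auto
      then show ?thesis by simp
    qed
    have "continuous_map mtopology euclideanreal h"
    proof -
      have "\<exists>\<delta>>0. \<forall>x. x \<in> M \<and> d a x < \<delta> \<longrightarrow> dist (h a) (h x) < e" if "a \<in> M" "e > 0" for a e
        using that h_le[of a] h_le[of _ a]
        by (intro exI[of _ e]) (smt (verit) commute dist_real_def)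
      then show ?thesis
        using metric_continuous_map[OF Met_TC.Metric_space_axioms, of h] by auto
    qed
    then have "continuous_map T euclideanreal h"
      by (simp add: T)
    moreover have "U = {x \<in> topspace T. 0 < h x}"
    proof -
      have "0 < h x \<longleftrightarrow> x \<in> U" if "x \<in> M" for x
      proof
        assume "x \<in> U"
        then obtain r where "r > 0" "mball x r \<subseteq> U"
          using assms(2) T by (auto simp: openin_mtopology)
        then have "r \<le> d x y" if "y \<in> C" for y
          using that \<open>x \<in> M\<close> by (force simp: C_def)
        then have "r \<le> h x"
          unfolding h_def using False by (intro cINF_greatest) auto
        with \<open>r > 0\<close> show "0 < h x" by simp
      next
        assume "0 < h x"
        show "x \<in> U"
        proof (rule ccontr)
          assume "x \<notin> U"
          then have "x \<in> C" using that by (simp add: C_def)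
          then have "h x \<le> d x x"
            unfolding h_def using bdd by (intro cINF_lower)
          then show False using \<open>0 < h x\<close> that by simp
        qed
      qed
      then show ?thesis
        using openin_subset[OF assms(2)] T by auto
    qed
    ultimately show ?thesis
      using h_nonneg by (intro that[of h]) auto
  qed
qed

text \<open>The functions \<open>min 1 (m * f)\<close>, with \<open>f\<close> positive exactly on
  the open set \<open>U\<close>, increase to the indicator of \<open>U\<close>. Dominated
  convergence thus carries the equality over to open sets, an intersection-stable generator.\<close>

lemma measure_eqI_continuous_map:
  assumes T: "metrizable_space T"
    and M: "finite_measure M" "sets M = sets (borel_of T)"
    and N: "finite_measure N" "sets N = sets (borel_of T)"
    and eq: "\<And>f. continuous_map T euclideanreal f \<Longrightarrow> (\<integral>x. f x \<partial>M) = (\<integral>x. f x \<partial>N)"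
  shows "M = N"
proof (rule measure_eqI_generator_eq[where \<Omega>="topspace T" and E="{U. openin T U}"
      and A="\<lambda>_. topspace T"])
  interpret M: finite_measure M by fact
  interpret N: finite_measure N by fact
  show "emeasure M U = emeasure N U" if "U \<in> {U. openin T U}" for U
  proof -
    from that have "openin T U" by simp
    then obtain f :: "_ \<Rightarrow> real" where f: "continuous_map T euclideanreal f"
        "\<And>x. 0 \<le> f x"
      and U: "U = {x \<in> topspace T. 0 < f x}"
      using metrizable_openin_eq_positive[OF T] by metis
    define g where "g m x = min 1 (real m * f x)" for m x
    have g: "continuous_map T euclideanreal (g m)" for m
      unfolding g_def using f(1) by (intro continuous_intros continuous_map_real_mult_left) auto
    have lim: "(\<lambda>m. g m x) \<longlonglongrightarrow> indicator U x" if "x \<in> topspace T" for x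
    proof (cases "x \<in> U")
      case True
      then have "0 < f x" using U by simp
      obtain m0 where "1 < real m0 * f x"
        using reals_Archimedean3[OF \<open>0 < f x\<close>] by blast
      moreover have "real m0 * f x \<le> real m * f x" if "m0 \<le> m" for m
        using that \<open>0 < f x\<close> by (intro mult_right_mono) auto
      ultimately have "g m x = 1" if "m0 \<le> m" for m
        unfolding g_def using that by (intro min_absorb1) force
      then have "eventually (\<lambda>m. g m x = 1) sequentially"
        by (auto simp: eventually_sequentially)
      then show ?thesis
        using True by (simp add: tendsto_eventually)
    next
      case False
      then have "f x = 0" using U that f(2)[of x] by fastforce
      then show ?thesis using False by (simp add: g_def)
    qed
    have "(\<lambda>m. \<integral>x. g m x \<partial>K) \<longlonglongrightarrow> measure K U"
      if "finite_measure K" "sets K = sets (borel_of T)" for K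
    proof -
      interpret finite_measure K by fact
      have sp: "space K = topspace T"
        using sets_eq_imp_space_eq[OF that(2)] by simp
      have "U \<in> sets K"
        using \<open>openin T U\<close> that by (auto simp: sets_borel_of)
      have "(\<lambda>m. \<integral>x. g m x \<partial>K) \<longlonglongrightarrow> (\<integral>x. indicator U x \<partial>K)"
      proof (rule integral_dominated_convergence[where w="\<lambda>_. 1"])
        show "(indicator U :: _ \<Rightarrow> real) \<in> borel_measurable K"
          using \<open>U \<in> sets K\<close> by simp
        show "g m \<in> borel_measurable K" for m
          using continuous_map_borel_measurable[OF that(2) g] .
        show "AE x in K. (\<lambda>m. g m x) \<longlonglongrightarrow> indicator U x"
          using lim sp by (intro AE_I2) simp
        show "AE x in K. norm (g m x) \<le> 1" for m
          using f(2) by (intro AE_I2) (simp add: g_def)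
      qed simp
      then show ?thesis
        using \<open>U \<in> sets K\<close> by simp
    qed
    from this[OF M] this[OF N] have "measure M U = measure N U"
      by (simp add: eq[OF g] LIMSEQ_unique)
    then show ?thesis
      by (simp add: M.emeasure_eq_measure N.emeasure_eq_measure)
  qed
  show "emeasure M (topspace T) \<noteq> \<infinity>"
    using M.emeasure_finite[of "topspace T"] by simp
  show "{U. openin T U} \<subseteq> Pow (topspace T)"
    by (auto dest: openin_subset)
qed (auto simp: M(2) N(2) sets_borel_of Int_stable_def)

section \<open>Hahn-Banach theorem for sublinear functionals on function spaces\<close>

text \<open>Scaling is asked only as an inequality, which is easier to check for infima. Applying it
  to \<open>inverse a\<close> as well gives equality, and from that the value 0 at the zero
  function.\<close>

definition sublinear_on :: "('b \<Rightarrow> real) set \<Rightarrow> (('b \<Rightarrow> real) \<Rightarrow> real) \<Rightarrow> bool" where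
  "sublinear_on E p \<longleftrightarrow>
    (\<forall>f\<in>E. \<forall>g\<in>E. p (\<lambda>x. f x + g x) \<le> p f + p g) \<and>
    (\<forall>f\<in>E. \<forall>a>0. p (\<lambda>x. a * f x) \<le> a * p f)"

text \<open>The space is a set of functions rather than a type, so that the continuous functions of
  any given topology form an instance.\<close>

locale function_space =
  fixes E :: "('b \<Rightarrow> real) set"
  assumes add_closed: "f \<in> E \<Longrightarrow> g \<in> E \<Longrightarrow> (\<lambda>x. f x + g x) \<in> E"
    and scale_closed: "f \<in> E \<Longrightarrow> (\<lambda>x. a * f x) \<in> E"
begin

lemma uminus_closed: "f \<in> E \<Longrightarrow> (\<lambda>x. - f x) \<in> E"
  using scale_closed[of f "-1"] by simp

lemma sublinear_on_add:
  "sublinear_on E p \<Longrightarrow> f \<in> E \<Longrightarrow> g \<in> E \<Longrightarrow> p (\<lambda>x. f x + g x) \<le> p f + p g"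
  by (simp add: sublinear_on_def)

lemma sublinear_on_scale_le:
  "sublinear_on E p \<Longrightarrow> f \<in> E \<Longrightarrow> 0 < a \<Longrightarrow> p (\<lambda>x. a * f x) \<le> a * p f"
  by (simp add: sublinear_on_def)

lemma sublinear_on_scale:
  assumes "sublinear_on E p" "f \<in> E" "0 < a"
  shows "p (\<lambda>x. a * f x) = a * p f"
proof (rule antisym)
  have "p f \<le> inverse a * p (\<lambda>x. a * f x)"
    using sublinear_on_scale_le[OF assms(1) scale_closed[OF assms(2)], of "inverse a" a] assms(3)
    by (simp flip: mult.assoc)
  then show "a * p f \<le> p (\<lambda>x. a * f x)"
    using assms(3) by (simp add: field_simps)
qed (rule sublinear_on_scale_le[OF assms])

lemma sublinear_on_zero:
  assumes "sublinear_on E p" "f \<in> E"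
  shows "p (\<lambda>x. 0) = 0"
  using sublinear_on_scale[OF assms(1) scale_closed[OF assms(2), of 0], of 2] by simp

lemma sublinear_on_ge_uminus:
  assumes "sublinear_on E p" "f \<in> E"
  shows "- p (\<lambda>x. - f x) \<le> p f"
  using sublinear_on_add[OF assms uminus_closed[OF assms(2)]] sublinear_on_zero[OF assms] by simp

text \<open>
  Any sublinear functional can be lowered so as to become linear along a prescribed vector \<open>y\<close>;
  hence the minimal ones are linear.
\<close>

lemma sublinear_on_lower:
  assumes p: "sublinear_on E p" and y: "y \<in> E"
  obtains q where "sublinear_on E q" "\<And>f. f \<in> E \<Longrightarrow> q f \<le> p f"
    "\<And>f. f \<notin> E \<Longrightarrow> q f = 0" "\<And>f. f \<in> E \<Longrightarrow> q f \<le> p (\<lambda>x. f x + y x) - p y"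
proof -
  \<comment> \<open>\<open>A f t\<close> is the value of \<open>p\<close> at \<open>f\<close>
    shifted by \<open>t * y\<close>, less the amount \<open>t * p y\<close> due to the shift. The
    infimum over \<open>t\<close> is the lowered functional; the term \<open>t = 1\<close> gives the
    last claimed bound.\<close>
  define A where "A f t = p (\<lambda>x. f x + t * y x) - t * p y" for f t
  \<comment> \<open>The fixed value 0 outside \<open>E\<close> makes functionals that agree on
    \<open>E\<close> equal as functions, as the minimality argument requires.\<close>
  define q where "q f = (if f \<in> E then INF t\<in>{0<..}. A f t else 0)" for f
  have mem: "(\<lambda>x. f x + t * y x) \<in> E" if "f \<in> E" for f t
    using add_closed[OF that scale_closed[OF y]] by simp
  have bdd: "bdd_below (A f ` {0<..})" if f: "f \<in> E" for f
  proof (rule bdd_belowI2)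
    fix t :: real assume "t \<in> {0<..}"
    then have "t * p y = p (\<lambda>x. t * y x)"
      using sublinear_on_scale[OF p y] by simp
    also have "\<dots> = p (\<lambda>x. (f x + t * y x) + - f x)"
      by simp
    also have "\<dots> \<le> p (\<lambda>x. f x + t * y x) + p (\<lambda>x. - f x)"
      using sublinear_on_add[OF p mem[OF f] uminus_closed[OF f]] .
    finally show "- p (\<lambda>x. - f x) \<le> A f t"
      by (simp add: A_def)
  qed
  have q_le: "q f \<le> A f t" if "f \<in> E" "0 < t" for f t
    using cINF_lower[OF bdd[OF that(1)], of t] that by (simp add: q_def)
  have q_ge: "u \<le> q f" if "f \<in> E" "\<And>t. 0 < t \<Longrightarrow> u \<le> A f t" for f u
    unfolding q_def using that by (auto intro!: cINF_greatest)
  have "sublinear_on E q"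
    unfolding sublinear_on_def
  proof (intro conjI ballI allI impI)
    fix f g assume f: "f \<in> E" and g: "g \<in> E"
    have *: "q (\<lambda>x. f x + g x) \<le> A f s + A g t" if "0 < s" "0 < t" for s t
    proof -
      \<comment> \<open>With the parameters added, the shifted sum splits into the two shifted
        summands and the multiples of \<open>p y\<close> match.\<close>
      have "q (\<lambda>x. f x + g x) \<le> A (\<lambda>x. f x + g x) (s + t)"
        using q_le add_closed[OF f g] that by simp
      also have "\<dots> \<le> A f s + A g t"
        using sublinear_on_add[OF p mem[OF f] mem[OF g], of s t]
        by (simp add: A_def algebra_simps)
      finally show ?thesis .
    qed
    have "q (\<lambda>x. f x + g x) - A g t \<le> q f" if "0 < t" for t
      using * that f by (intro q_ge) (auto simp: algebra_simps)
    then have "q (\<lambda>x. f x + g x) - q f \<le> q g"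
      using g by (intro q_ge) (auto simp: algebra_simps)
    then show "q (\<lambda>x. f x + g x) \<le> q f + q g" by simp
  next
    fix f and a :: real assume f: "f \<in> E" and a: "0 < a"
    have "q (\<lambda>x. a * f x) / a \<le> A f t" if "0 < t" for t
    proof -
      have "q (\<lambda>x. a * f x) \<le> A (\<lambda>x. a * f x) (a * t)"
        using q_le scale_closed[OF f] a that by simp
      also have "\<dots> = a * A f t"
        using sublinear_on_scale[OF p mem[OF f] a, of t] by (simp add: A_def algebra_simps)
      finally show ?thesis
        using a by (simp add: field_simps)
    qed
    then have "q (\<lambda>x. a * f x) / a \<le> q f"
      by (rule q_ge[OF f])
    then show "q (\<lambda>x. a * f x) \<le> a * q f"
      using a by (simp add: field_simps)
  qed
  moreover have "q f \<le> p (\<lambda>x. f x + y x) - p y" if "f \<in> E" for f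
    using q_le[OF that, of 1] by (simp add: A_def)
  moreover have "q f \<le> p f" if f: "f \<in> E" for f
    using calculation(2)[OF f] sublinear_on_add[OF p f y] by simp
  ultimately show ?thesis
    using that[of q] by (simp add: q_def)
qed

text \<open>Zorn's lemma yields a minimal sublinear functional below \<open>p'\<close>, and
  \<open>sublinear_on_lower\<close> shows that a minimal one is additive. Starting from
  \<open>p'\<close>, which is \<open>p\<close> lowered along \<open>y\<close>, secures the value at
  \<open>y\<close>: at \<open>- y\<close> it is at most \<open>- p y\<close>, so \<open>L y\<close>
  is at least \<open>p y\<close>.\<close>

theorem Hahn_Banach_dominated:
  assumes p: "sublinear_on E p" and y: "y \<in> E"
  shows "\<exists>L. (\<forall>f\<in>E. \<forall>g\<in>E. L (\<lambda>x. f x + g x) = L f + L g) \<and>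
    (\<forall>f\<in>E. \<forall>a. L (\<lambda>x. a * f x) = a * L f) \<and> (\<forall>f\<in>E. L f \<le> p f) \<and> L y = p y"
proof -
  obtain p' where p': "sublinear_on E p'" "\<And>f. f \<in> E \<Longrightarrow> p' f \<le> p f"
    "\<And>f. f \<notin> E \<Longrightarrow> p' f = 0" "\<And>f. f \<in> E \<Longrightarrow> p' f \<le> p (\<lambda>x. f x + y x) - p y"
    using sublinear_on_lower[OF p y] by metis
  define S where "S = {q. sublinear_on E q \<and> (\<forall>f\<in>E. q f \<le> p' f) \<and> (\<forall>f. f \<notin> E \<longrightarrow> q f = 0)}"
  \<comment> \<open>Zorn's lemma is applied to the reversed order, so that its maximal element is a
    minimal functional.\<close>
  have "\<exists>m\<in>S. \<forall>q\<in>S. q \<le> m \<longrightarrow> q = m"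
  proof (rule predicate_Zorn)
    show "partial_order_on S (relation_of (\<lambda>m q. q \<le> m) S)"
      by (rule partial_order_on_relation_ofI) auto
  next
    fix C assume "C \<in> Chains (relation_of (\<lambda>m q. q \<le> m) S)"
    then have CS: "C \<subseteq> S" and chain: "\<And>q r. q \<in> C \<Longrightarrow> r \<in> C \<Longrightarrow> q \<le> r \<or> r \<le> q"
      by (auto simp: Chains_def relation_of_def)
    show "\<exists>u\<in>S. \<forall>a\<in>C. u \<le> a"
    proof (cases "C = {}")
      case True
      then show ?thesis using p' by (auto simp: S_def)
    next
      case False
      define u where "u f = (if f \<in> E then INF q\<in>C. q f else 0)" for f
      \<comment> \<open>The pointwise infimum of the chain is finite because a sublinear
        \<open>q\<close> below \<open>p'\<close> satisfies
        \<open>q f \<ge> - q (- f) \<ge> - p' (- f)\<close>.\<close>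
      have bdd: "bdd_below ((\<lambda>q. q f) ` C)" if f: "f \<in> E" for f
      proof (rule bdd_belowI2)
        fix q assume "q \<in> C"
        then have "sublinear_on E q" "q (\<lambda>x. - f x) \<le> p' (\<lambda>x. - f x)"
          using CS uminus_closed[OF f] by (auto simp: S_def)
        then show "- p' (\<lambda>x. - f x) \<le> q f"
          using sublinear_on_ge_uminus[of q f] f by simp
      qed
      have u_le: "u f \<le> q f" if "f \<in> E" "q \<in> C" for f q
        using cINF_lower[OF bdd[OF that(1)] that(2)] that by (simp add: u_def)
      have u_ge: "a \<le> u f" if "f \<in> E" "\<And>q. q \<in> C \<Longrightarrow> a \<le> q f" for f a
        unfolding u_def using that False by (auto intro!: cINF_greatest)
      have "sublinear_on E u"
        unfolding sublinear_on_def
      proof (intro conjI ballI allI impI)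
        fix f g assume f: "f \<in> E" and g: "g \<in> E"
        have *: "u (\<lambda>x. f x + g x) \<le> q f + r g" if qr: "q \<in> C" "r \<in> C" for q r
        proof -
          \<comment> \<open>The smaller of \<open>q\<close> and \<open>r\<close> can be used for
            both summands; this is where the chain property enters.\<close>
          obtain s where s: "s \<in> C" "s \<le> q" "s \<le> r"
            using chain[OF qr] qr by auto
          have "u (\<lambda>x. f x + g x) \<le> s (\<lambda>x. f x + g x)"
            using u_le add_closed[OF f g] s(1) by blast
          also have "\<dots> \<le> s f + s g"
            using CS s(1) f g by (auto simp: S_def intro: sublinear_on_add)
          also have "\<dots> \<le> q f + r g"
            using s by (intro add_mono) (auto simp: le_fun_def)
          finally show ?thesis .
        qed
        have "u (\<lambda>x. f x + g x) - r g \<le> u f" if "r \<in> C" for r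
          using * that f by (intro u_ge) (auto simp: algebra_simps)
        then have "u (\<lambda>x. f x + g x) - u f \<le> u g"
          using g by (intro u_ge) (auto simp: algebra_simps)
        then show "u (\<lambda>x. f x + g x) \<le> u f + u g" by simp
      next
        fix f and a :: real assume f: "f \<in> E" and a: "0 < a"
        have "u (\<lambda>x. a * f x) / a \<le> q f" if "q \<in> C" for q
        proof -
          have "u (\<lambda>x. a * f x) \<le> q (\<lambda>x. a * f x)"
            using u_le[OF scale_closed[OF f] that] .
          also have "\<dots> \<le> a * q f"
            using CS that f a by (auto simp: S_def intro: sublinear_on_scale_le)
          finally show ?thesis using a by (simp add: field_simps)
        qed
        then have "u (\<lambda>x. a * f x) / a \<le> u f"
          by (rule u_ge[OF f])
        then show "u (\<lambda>x. a * f x) \<le> a * u f"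
          using a by (simp add: field_simps)
      qed
      moreover have "u f \<le> p' f" if "f \<in> E" for f
      proof -
        obtain q where "q \<in> C" using False by blast
        then show ?thesis using u_le[OF that, of q] CS that by (force simp: S_def)
      qed
      ultimately have "u \<in> S"
        by (simp add: S_def u_def)
      moreover have "u \<le> q" if "q \<in> C" for q
        using u_le[OF _ that] CS that by (auto simp: le_fun_def S_def u_def)
      ultimately show ?thesis by blast
    qed
  qed
  then obtain L where L: "sublinear_on E L" "\<And>f. f \<in> E \<Longrightarrow> L f \<le> p' f" "\<And>f. f \<notin> E \<Longrightarrow> L f = 0"
    and minimal: "\<And>q. q \<in> S \<Longrightarrow> q \<le> L \<Longrightarrow> q = L"
    by (auto simp: S_def)
  have add: "L (\<lambda>x. f x + g x) = L f + L g" if f: "f \<in> E" and g: "g \<in> E" for f g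
  proof -
    \<comment> \<open>Lowering the minimal \<open>L\<close> along \<open>g\<close> cannot change it,
      so the bound on the lowered functional holds for \<open>L\<close> itself: this is
      superadditivity.\<close>
    obtain q where q: "sublinear_on E q" "\<And>f. f \<in> E \<Longrightarrow> q f \<le> L f"
      "\<And>f. f \<notin> E \<Longrightarrow> q f = 0" "\<And>f. f \<in> E \<Longrightarrow> q f \<le> L (\<lambda>x. f x + g x) - L g"
      using sublinear_on_lower[OF L(1) g] by metis
    have "q \<in> S"
      using q L(2) by (force simp: S_def)
    moreover have "q h \<le> L h" for h
      using q(2,3)[of h] L(3)[of h] by (cases "h \<in> E") auto
    ultimately have "q = L"
      by (intro minimal) (auto simp: le_fun_def)
    then show ?thesis
      using q(4)[OF f] sublinear_on_add[OF L(1) f g] by simp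
  qed
  have neg: "L (\<lambda>x. - f x) = - L f" if "f \<in> E" for f
    using add[OF that uminus_closed[OF that]] sublinear_on_zero[OF L(1) that] by simp
  have scale: "L (\<lambda>x. a * f x) = a * L f" if f: "f \<in> E" for f a
  proof (cases a "0::real" rule: linorder_cases)
    case less
    then have "L (\<lambda>x. - (- a * f x)) = - (- a * L f)"
      using neg[OF scale_closed[OF f, of "- a"]] sublinear_on_scale[OF L(1) f, of "- a"] by simp
    then show ?thesis by simp
  next
    case equal
    then show ?thesis using sublinear_on_zero[OF L(1) f] by simp
  next
    case greater
    then show ?thesis using sublinear_on_scale[OF L(1) f] by simp
  qed
  have "- L y \<le> - p y"
    using neg[OF y] L(2)[OF uminus_closed[OF y]] p'(4)[OF uminus_closed[OF y]]
      sublinear_on_zero[OF p y] by simp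
  moreover have "L f \<le> p f" if "f \<in> E" for f
    using L(2)[OF that] p'(2)[OF that] by simp
  ultimately show ?thesis
    using add scale y by (intro exI[of _ L]) (auto intro: antisym)
qed

end

section \<open>Riesz representation on compact metrizable spaces\<close>

text \<open>\<open>L\<close> is a total function whose behaviour is prescribed on continuous
  functions only; this is what the Hahn-Banach functional offers.\<close>

locale positive_functional =
  fixes T :: "'b topology" and L :: "('b \<Rightarrow> real) \<Rightarrow> real"
  assumes compact: "compact_space T" and metrizable: "metrizable_space T"
    and add: "continuous_map T euclideanreal f \<Longrightarrow> continuous_map T euclideanreal g
      \<Longrightarrow> L (\<lambda>x. f x + g x) = L f + L g"
    and scale: "continuous_map T euclideanreal f \<Longrightarrow> L (\<lambda>x. a * f x) = a * L f"
    and nonneg: "continuous_map T euclideanreal f \<Longrightarrow> (\<And>x. x \<in> topspace T \<Longrightarrow> 0 \<le> f x) \<Longrightarrow> 0 \<le> L f"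
begin

lemma zero: "L (\<lambda>x. 0) = 0"
  using scale[of "\<lambda>x. 0" 0] by simp

lemma const: "L (\<lambda>x. a) = a * L (\<lambda>x. 1)"
  using scale[of "\<lambda>x. 1" a] by simp

lemma mono:
  assumes "continuous_map T euclideanreal f" "continuous_map T euclideanreal g"
    and "\<And>x. x \<in> topspace T \<Longrightarrow> f x \<le> g x"
  shows "L f \<le> L g"
proof -
  have "0 \<le> L (\<lambda>x. g x + - 1 * f x)"
    using assms by (intro nonneg continuous_intros) auto
  also have "\<dots> = L g + - 1 * L f"
    using assms by (subst add) (auto intro!: continuous_intros simp only: scale)
  finally show ?thesis by simp
qed

lemma sum:
  assumes "finite I" "\<And>i. i \<in> I \<Longrightarrow> continuous_map T euclideanreal (f i)"
  shows "L (\<lambda>x. \<Sum>i\<in>I. f i x) = (\<Sum>i\<in>I. L (f i))"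
  using assms by (induction I) (auto simp: zero add continuous_map_sum)

lemma one_nonneg: "0 \<le> L (\<lambda>x. 1)"
  by (rule nonneg) auto

section \<open>Content of open sets and the outer measure it induces\<close>

definition below :: "'b set \<Rightarrow> ('b \<Rightarrow> real) set" where
  "below U = {f. continuous_map T euclideanreal f \<and>
    (\<forall>x\<in>topspace T. 0 \<le> f x \<and> f x \<le> indicator U x)}"

text \<open>This becomes the measure of the open set \<open>U\<close>. The test functions in
  \<open>below U\<close> vanish outside \<open>U\<close> but need not have compact support inside
  it; \<open>truncate\<close> makes up for that.\<close>

definition open_content :: "'b set \<Rightarrow> ennreal" where
  "open_content U = (SUP f\<in>below U. ennreal (L f))"

definition outer_content :: "'b set \<Rightarrow> ennreal" where
  "outer_content A = (INF U\<in>{U. openin T U \<and> A \<subseteq> U}. open_content U)"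

lemma zero_in_below: "(\<lambda>x. 0) \<in> below U"
  by (simp add: below_def)

lemma belowD:
  assumes "f \<in> below U"
  shows "continuous_map T euclideanreal f"
    and "x \<in> topspace T \<Longrightarrow> 0 \<le> f x"
    and "x \<in> topspace T \<Longrightarrow> f x \<le> 1"
    and "x \<in> topspace T \<Longrightarrow> x \<notin> U \<Longrightarrow> f x = 0"
proof -
  have *: "0 \<le> f x" "f x \<le> indicator U x" if "x \<in> topspace T" for x
    using assms that by (auto simp: below_def)
  show "continuous_map T euclideanreal f"
    using assms by (simp add: below_def)
  show "x \<in> topspace T \<Longrightarrow> 0 \<le> f x"
    by (rule *)
  show "x \<in> topspace T \<Longrightarrow> f x \<le> 1"
    using *(2)[of x] by (cases "x \<in> U") auto
  show "x \<in> topspace T \<Longrightarrow> x \<notin> U \<Longrightarrow> f x = 0"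
    using *[of x] by simp
qed

lemma below_nonneg: "f \<in> below U \<Longrightarrow> 0 \<le> L f"
  using belowD nonneg by blast

lemma below_mono: "U \<subseteq> V \<Longrightarrow> below U \<subseteq> below V"
  by (auto simp: below_def indicator_def)

lemma open_content_mono: "U \<subseteq> V \<Longrightarrow> open_content U \<le> open_content V"
  unfolding open_content_def by (intro SUP_subset_mono below_mono) auto

lemma le_open_content: "f \<in> below U \<Longrightarrow> ennreal (L f) \<le> open_content U"
  unfolding open_content_def by (rule SUP_upper)

lemma open_content_le:
  "(\<And>f. f \<in> below U \<Longrightarrow> ennreal (L f) \<le> a) \<Longrightarrow> open_content U \<le> a"
  unfolding open_content_def by (rule SUP_least)

lemma open_content_topspace: "open_content (topspace T) = ennreal (L (\<lambda>x. 1))"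
proof (rule antisym)
  show "open_content (topspace T) \<le> ennreal (L (\<lambda>x. 1))"
    using belowD by (intro open_content_le ennreal_leI mono) auto
  show "ennreal (L (\<lambda>x. 1)) \<le> open_content (topspace T)"
    by (rule le_open_content) (simp add: below_def)
qed

lemma outer_content_le:
  "openin T U \<Longrightarrow> A \<subseteq> U \<Longrightarrow> outer_content A \<le> open_content U"
  unfolding outer_content_def by (rule INF_lower) simp

lemma le_outer_content:
  "(\<And>U. openin T U \<Longrightarrow> A \<subseteq> U \<Longrightarrow> a \<le> open_content U) \<Longrightarrow> a \<le> outer_content A"
  unfolding outer_content_def by (rule INF_greatest) simp

lemma outer_content_open: "openin T U \<Longrightarrow> outer_content U = open_content U"
  by (intro antisym outer_content_le le_outer_content open_content_mono) auto

lemma outer_content_mono: "A \<subseteq> B \<Longrightarrow> outer_content A \<le> outer_content B"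
  by (intro le_outer_content outer_content_le) auto

text \<open>
  Passing from \<open>f\<close> to \<open>max 0 (f - \<epsilon>)\<close> costs little and moves the support into the
  compact set \<open>{x. \<epsilon> \<le> f x}\<close>.
\<close>

lemma truncate:
  assumes f: "continuous_map T euclideanreal f" and e: "0 < e"
  obtains \<epsilon> where "0 < \<epsilon>" "L f \<le> L (\<lambda>x. max 0 (f x - \<epsilon>)) + e"
proof -
  define \<epsilon> where "\<epsilon> = e / (L (\<lambda>x. 1) + 1)"
  have "0 < \<epsilon>" "\<epsilon> * L (\<lambda>x. 1) \<le> e"
    using one_nonneg e by (auto simp: \<epsilon>_def field_simps)
  have cont: "continuous_map T euclideanreal (\<lambda>x. max 0 (f x - \<epsilon>))"
    using f by (intro continuous_intros) auto
  have "L f \<le> L (\<lambda>x. max 0 (f x - \<epsilon>) + \<epsilon>)"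
    using f by (intro mono continuous_intros) auto
  also have "\<dots> = L (\<lambda>x. max 0 (f x - \<epsilon>)) + \<epsilon> * L (\<lambda>x. 1)"
    using add[OF cont, of "\<lambda>x. \<epsilon>"] const[of \<epsilon>] by simp
  finally show ?thesis
    using that[of \<epsilon>] \<open>0 < \<epsilon>\<close> \<open>\<epsilon> * L (\<lambda>x. 1) \<le> e\<close> by simp
qed

text \<open>After truncation a test function for the union vanishes off a compact set
  \<open>K\<close>. Finitely many of the \<open>U i\<close> cover \<open>K\<close>, and a finite sum
  of test functions for these dominates the truncated function.\<close>

lemma open_content_UN_le:
  assumes U: "\<And>i::nat. openin T (U i)"
  shows "open_content (\<Union>i. U i) \<le> (\<Sum>i. open_content (U i))"
proof (rule open_content_le, rule ennreal_le_epsilon)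
  fix f and e :: real assume f: "f \<in> below (\<Union>i. U i)" and "0 < e"
  obtain \<epsilon> where "0 < \<epsilon>" and \<epsilon>: "L f \<le> L (\<lambda>x. max 0 (f x - \<epsilon>)) + e"
    using truncate[OF belowD(1)[OF f] \<open>0 < e\<close>] by blast
  define f' where "f' x = max 0 (f x - \<epsilon>)" for x
  have f': "continuous_map T euclideanreal f'"
    unfolding f'_def using belowD(1)[OF f] by (intro continuous_intros) auto
  define K where "K = {x \<in> topspace T. f x \<in> {\<epsilon>..}}"
  have "closedin T K"
    unfolding K_def using belowD(1)[OF f] by (intro closedin_continuous_map_preimage) auto
  then have "compactin T K"
    using compact closedin_compact_space by blast
  have "\<forall>i. \<exists>h::'b \<Rightarrow> real. continuous_map T euclideanreal h \<and> (\<forall>x. 0 \<le> h x) \<and>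
    U i = {x \<in> topspace T. 0 < h x}"
    using metrizable_openin_eq_positive[OF metrizable U] by metis
  then obtain h :: "nat \<Rightarrow> 'b \<Rightarrow> real" where h: "\<And>i. continuous_map T euclideanreal (h i)"
    "\<And>i x. 0 \<le> h i x" and Uh: "\<And>i. U i = {x \<in> topspace T. 0 < h i x}"
    by metis
  \<comment> \<open>Each \<open>U i\<close> is exhausted by the open sets where a multiple
    \<open>m * h i\<close> exceeds 1, that is, where the cut-off \<open>min 1 (m * h i)\<close> has
    already reached 1. Compactness is applied to all these sets at once.\<close>
  define V where "V p = {x \<in> topspace T. real (snd p) * h (fst p) x \<in> {1<..}}" for p :: "nat \<times> nat"
  have V: "openin T (V p)" for p
    unfolding V_def using h
    by (intro openin_continuous_map_preimage[where Y=euclideanreal] continuous_map_real_mult_left) auto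
  have "K \<subseteq> \<Union>(range V)"
  proof
    fix x assume "x \<in> K"
    then have x: "x \<in> topspace T" "0 < f x"
      using \<open>0 < \<epsilon>\<close> by (auto simp: K_def)
    then have "x \<in> (\<Union>i. U i)"
      using belowD(4)[OF f] by force
    then obtain i where "0 < h i x" using Uh by auto
    then obtain m where "1 < real m * h i x"
      using reals_Archimedean3 by blast
    then show "x \<in> \<Union>(range V)"
      using x by (intro UN_I[of "(i, m)"]) (auto simp: V_def)
  qed
  with V obtain F where F: "finite F" "F \<subseteq> range V" "K \<subseteq> \<Union>F"
    using compactinD[OF \<open>compactin T K\<close>, of "range V"] by (metis rangeE)
  obtain P where "finite P" "F = V ` P"
    using finite_subset_image[OF F(1,2)] by auto
  with F(3) have P: "finite P" "K \<subseteq> \<Union>(V ` P)"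
    by auto
  define J where "J = fst ` P"
  \<comment> \<open>One multiplier large enough for every pair of the finite subcover.\<close>
  obtain M where M: "\<And>p. p \<in> P \<Longrightarrow> snd p \<le> M"
    using finite_nat_set_iff_bounded_le[of "snd ` P"] P(1) by auto
  define g where "g i x = min 1 (real M * h i x)" for i x
  have g: "g i \<in> below (U i)" for i
  proof -
    have "continuous_map T euclideanreal (g i)"
      unfolding g_def using h by (intro continuous_intros continuous_map_real_mult_left) auto
    moreover have "g i x = 0" if "x \<in> topspace T" "x \<notin> U i" for x
      using that Uh[of i] h(2)[of i x] by (force simp: g_def)
    ultimately show ?thesis
      using h(2)[of i] by (auto simp: below_def g_def indicator_def)
  qed
  \<comment> \<open>On \<open>K\<close> some \<open>g i\<close> equals 1, which is at least
    \<open>f'\<close>; off \<open>K\<close> the left side is 0.\<close>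
  have "L f' \<le> L (\<lambda>x. \<Sum>i\<in>J. g i x)"
  proof (rule mono[OF f'])
    show "continuous_map T euclideanreal (\<lambda>x. \<Sum>i\<in>J. g i x)"
      using P belowD(1)[OF g] by (intro continuous_intros) (auto simp: J_def)
    fix x assume x: "x \<in> topspace T"
    have g_nonneg: "0 \<le> g i x" for i using belowD(2)[OF g x] .
    show "f' x \<le> (\<Sum>i\<in>J. g i x)"
    proof (cases "x \<in> K")
      case True
      then obtain p where p: "p \<in> P" "x \<in> V p" using P(2) by auto
      have "real (snd p) * h (fst p) x \<le> real M * h (fst p) x"
        using M[OF p(1)] h(2) by (intro mult_right_mono) auto
      then have "g (fst p) x = 1"
        using p(2) by (auto simp: g_def V_def)
      then have "f' x \<le> g (fst p) x"
        using belowD(2,3)[OF f x] \<open>0 < \<epsilon>\<close> by (auto simp: f'_def)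
      also have "\<dots> \<le> (\<Sum>i\<in>J. g i x)"
        using P(1) p(1) g_nonneg by (intro member_le_sum) (auto simp: J_def)
      finally show ?thesis .
    next
      case False
      then have "f' x = 0"
        using x by (auto simp: K_def f'_def)
      then show ?thesis
        using g_nonneg by (simp add: sum_nonneg)
    qed
  qed
  also have "\<dots> = (\<Sum>i\<in>J. L (g i))"
    using P(1) belowD(1)[OF g] by (intro sum) (auto simp: J_def)
  finally have "ennreal (L f') \<le> ennreal (\<Sum>i\<in>J. L (g i))"
    by (rule ennreal_leI)
  also have "\<dots> = (\<Sum>i\<in>J. ennreal (L (g i)))"
    using below_nonneg[OF g] by simp
  also have "\<dots> \<le> (\<Sum>i\<in>J. open_content (U i))"
    by (intro sum_mono le_open_content g)
  also have "\<dots> \<le> (\<Sum>i. open_content (U i))"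
    using P(1) by (intro sum_le_suminf) (auto simp: J_def)
  finally have "ennreal (L f') \<le> (\<Sum>i. open_content (U i))" .
  moreover have "ennreal (L f) \<le> ennreal (L f') + ennreal e"
  proof -
    have "0 \<le> L f'" using f' by (intro nonneg) (auto simp: f'_def)
    then show ?thesis
      using \<epsilon> \<open>0 < e\<close> by (auto simp: f'_def[abs_def] simp flip: ennreal_plus intro!: ennreal_leI)
  qed
  ultimately show "ennreal (L f) \<le> (\<Sum>i. open_content (U i)) + ennreal e"
    by (meson add_right_mono order_trans)
qed

text \<open>This is the nontrivial half of Caratheodory's condition for \<open>U\<close>, tested on
  an open \<open>V\<close>. Let \<open>f\<close> be a test function for \<open>V \<inter> U\<close>.
  Its truncation \<open>f'\<close> vanishes on \<open>W\<close>, the part of \<open>V\<close> where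
  \<open>f < \<epsilon>\<close>, and \<open>W\<close> contains \<open>V - U\<close>. Adding to
  \<open>f'\<close> any test function for \<open>W\<close> therefore gives a test function for
  \<open>V\<close>.\<close>

lemma open_content_split:
  assumes U: "openin T U" and V: "openin T V"
  shows "open_content (V \<inter> U) + outer_content (V - U) \<le> open_content V"
proof -
  have main: "ennreal (L f) + outer_content (V - U) \<le> open_content V" if f: "f \<in> below (V \<inter> U)" for f
  proof (rule ennreal_le_epsilon)
    fix e :: real assume "0 < e"
    obtain \<epsilon> where "0 < \<epsilon>" and \<epsilon>: "L f \<le> L (\<lambda>x. max 0 (f x - \<epsilon>)) + e"
      using truncate[OF belowD(1)[OF f] \<open>0 < e\<close>] by blast
    define f' where "f' x = max 0 (f x - \<epsilon>)" for x
    have f': "continuous_map T euclideanreal f'"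
      unfolding f'_def using belowD(1)[OF f] by (intro continuous_intros) auto
    have Lf': "0 \<le> L f'" using f' by (intro nonneg) (auto simp: f'_def)
    define W where "W = V \<inter> {x \<in> topspace T. f x \<in> {..<\<epsilon>}}"
    have "openin T W"
      unfolding W_def using V belowD(1)[OF f]
      by (intro openin_Int openin_continuous_map_preimage[where Y=euclideanreal]) auto
    have "V - U \<subseteq> W"
      using openin_subset[OF V] belowD(4)[OF f] \<open>0 < \<epsilon>\<close> by (auto simp: W_def)
    have "ennreal (L f') + ennreal (L g) \<le> open_content V" if g: "g \<in> below W" for g
    proof -
      have "(\<lambda>x. f' x + g x) \<in> below V"
      proof -
        have "f' x + g x \<le> indicator V x" if x: "x \<in> topspace T" for x
        proof (cases "x \<in> W")
          case True
          then have "f' x = 0" "x \<in> V" by (auto simp: f'_def W_def)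
          then show ?thesis using belowD(3)[OF g x] by simp
        next
          case False
          then have "g x = 0" using belowD(4)[OF g x] by simp
          moreover have "f' x \<le> indicator V x"
            using belowD(3)[OF f x] belowD(4)[OF f x] \<open>0 < \<epsilon>\<close>
            by (cases "x \<in> V") (auto simp: f'_def)
          ultimately show ?thesis by simp
        qed
        then show ?thesis
          using continuous_map_add[OF f' belowD(1)[OF g]] belowD(2)[OF g]
          by (auto simp: below_def f'_def)
      qed
      then have "ennreal (L (\<lambda>x. f' x + g x)) \<le> open_content V"
        by (rule le_open_content)
      then show ?thesis
        using add[OF f' belowD(1)[OF g]] Lf' below_nonneg[OF g] by simp
    qed
    then have "(SUP g\<in>below W. ennreal (L f') + ennreal (L g)) \<le> open_content V"
      by (rule SUP_least)
    then have *: "ennreal (L f') + open_content W \<le> open_content V"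
      unfolding open_content_def[of W] using zero_in_below
      by (subst ennreal_SUP_add_right) auto
    have "ennreal (L f) \<le> ennreal (L f') + ennreal e"
      using \<epsilon> \<open>0 < e\<close> Lf' by (auto simp: f'_def[abs_def] simp flip: ennreal_plus intro!: ennreal_leI)
    then have "ennreal (L f) + outer_content (V - U) \<le> (ennreal (L f') + ennreal e) + open_content W"
      using outer_content_le[OF \<open>openin T W\<close> \<open>V - U \<subseteq> W\<close>] by (rule add_mono)
    also have "\<dots> \<le> open_content V + ennreal e"
      using add_right_mono[OF *, of "ennreal e"] by (simp add: ac_simps)
    finally show "ennreal (L f) + outer_content (V - U) \<le> open_content V + ennreal e" .
  qed
  show ?thesis
    unfolding open_content_def[of "V \<inter> U"] using zero_in_below main
    by (subst ennreal_SUP_add_left[symmetric]) (auto intro!: SUP_least)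
qed

lemma outer_content_UN_le:
  fixes A :: "nat \<Rightarrow> 'b set"
  assumes A: "\<And>i. A i \<subseteq> topspace T"
  shows "outer_content (\<Union>i. A i) \<le> (\<Sum>i. outer_content (A i))"
proof (rule ennreal_le_epsilon)
  fix e :: real assume "0 < e" "(\<Sum>i. outer_content (A i)) < top"
  \<comment> \<open>The errors \<open>e / 2 ^ (i + 1)\<close> add up to \<open>e\<close>. The
    approximating open sets exist because finiteness of the sum makes each outer content
    finite.\<close>
  have "\<exists>U. openin T U \<and> A i \<subseteq> U \<and> open_content U \<le> outer_content (A i) + ennreal (e * (1/2) ^ Suc i)" for i
  proof -
    have "outer_content (A i) \<noteq> \<infinity>"
      using \<open>(\<Sum>i. outer_content (A i)) < top\<close> by (auto dest!: ennreal_suminf_lessD simp: less_top)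
    then show ?thesis
      using INF_approx_ennreal[of "e * (1/2) ^ Suc i", OF _ outer_content_def] \<open>0 < e\<close>
      by (fastforce intro: less_imp_le)
  qed
  then obtain U where U: "\<And>i. openin T (U i)" "\<And>i. A i \<subseteq> U i"
    "\<And>i. open_content (U i) \<le> outer_content (A i) + ennreal (e * (1/2) ^ Suc i)"
    by metis
  have "outer_content (\<Union>i. A i) \<le> open_content (\<Union>i. U i)"
    using U by (intro outer_content_le) auto
  also have "\<dots> \<le> (\<Sum>i. open_content (U i))"
    by (rule open_content_UN_le[OF U(1)])
  also have "\<dots> \<le> (\<Sum>i. outer_content (A i) + ennreal (e * (1/2) ^ Suc i))"
    by (intro suminf_le U(3)) auto
  also have "\<dots> = (\<Sum>i. outer_content (A i)) + (\<Sum>i. ennreal e * ennreal ((1/2) ^ Suc i))"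
    using \<open>0 < e\<close> by (subst suminf_add[symmetric])
      (auto simp del: ennreal_suminf_cmult simp add: ennreal_mult[symmetric])
  also have "\<dots> = (\<Sum>i. outer_content (A i)) + ennreal e"
    unfolding ennreal_suminf_cmult
    by (subst suminf_ennreal_eq[OF zero_le_power power_half_series]) auto
  finally show "outer_content (\<Union>i. A i) \<le> (\<Sum>i. outer_content (A i)) + ennreal e" .
qed

lemma outer_content_empty: "outer_content {} = 0"
proof -
  have "open_content {} \<le> 0"
  proof (rule open_content_le)
    fix f assume f: "f \<in> below {}"
    have "L f \<le> L (\<lambda>x. 0)"
      using belowD(4)[OF f] by (intro mono belowD(1)[OF f]) auto
    then show "ennreal (L f) \<le> 0"
      by (simp add: zero ennreal_neg)
  qed
  then show ?thesis
    using outer_content_open[of "{}"] by simp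
qed

lemma outer_measure_space_outer_content: "outer_measure_space (Pow (topspace T)) outer_content"
  unfolding outer_measure_space_def
proof (intro conjI)
  show "positive (Pow (topspace T)) outer_content"
    by (simp add: positive_def outer_content_empty)
  show "increasing (Pow (topspace T)) outer_content"
    by (simp add: increasing_def outer_content_mono)
  show "countably_subadditive (Pow (topspace T)) outer_content"
    unfolding countably_subadditive_def by (auto intro!: outer_content_UN_le)
qed

text \<open>Every open \<open>V\<close> containing \<open>A\<close> is split by
  \<open>open_content_split\<close>; the infimum over \<open>V\<close> gives one inequality,
  subadditivity the other.\<close>

lemma openin_lambda_system:
  assumes U: "openin T U"
  shows "U \<in> lambda_system (topspace T) (Pow (topspace T)) outer_content"
proof -
  interpret Pow: sigma_algebra "topspace T" "Pow (topspace T)" by (rule sigma_algebra_Pow)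
  have sub: "subadditive (Pow (topspace T)) outer_content"
    using outer_measure_space_outer_content Pow.countably_subadditive_subadditive
    by (simp add: outer_measure_space_def)
  have "outer_content (A \<inter> U) + outer_content (A - U) = outer_content A" if A: "A \<subseteq> topspace T" for A
  proof (rule antisym)
    show "outer_content (A \<inter> U) + outer_content (A - U) \<le> outer_content A"
    proof (rule le_outer_content)
      fix V assume V: "openin T V" "A \<subseteq> V"
      have "outer_content (A \<inter> U) + outer_content (A - U) \<le> open_content (V \<inter> U) + outer_content (V - U)"
        using U V by (intro add_mono outer_content_le outer_content_mono) auto
      also have "\<dots> \<le> open_content V"
        by (rule open_content_split[OF U V(1)])
      finally show "outer_content (A \<inter> U) + outer_content (A - U) \<le> open_content V" .
    qed
    have "outer_content ((A \<inter> U) \<union> (A - U)) \<le> outer_content (A \<inter> U) + outer_content (A - U)"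
      using A by (intro subadditiveD[OF sub]) auto
    then show "outer_content A \<le> outer_content (A \<inter> U) + outer_content (A - U)"
      by (simp add: Int_Diff_Un)
  qed
  then show ?thesis
    using openin_subset[OF U] by (simp add: Pow.lambda_system_eq)
qed

section \<open>The measure obtained by Caratheodory's extension\<close>

definition riesz_measure :: "'b measure" where
  "riesz_measure = measure_of (topspace T) {U. openin T U} outer_content"

lemma sets_riesz_measure: "sets riesz_measure = sets (borel_of T)"
  unfolding riesz_measure_def sets_borel_of
  by (intro sets_measure_of) (auto dest: openin_subset)

lemma space_riesz_measure: "space riesz_measure = topspace T"
  using sets_eq_imp_space_eq[OF sets_riesz_measure] by simp

text \<open>The outer content is a measure on the sigma-algebra of Caratheodory-measurable sets,
  which contains the open sets and hence the Borel sets. This also rules out that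
  \<open>measure_of\<close> falls back to the zero measure.\<close>

lemma emeasure_riesz_measure:
  assumes "openin T U"
  shows "emeasure riesz_measure U = open_content U"
proof -
  interpret Pow: sigma_algebra "topspace T" "Pow (topspace T)" by (rule sigma_algebra_Pow)
  have ms: "measure_space (topspace T) (lambda_system (topspace T) (Pow (topspace T)) outer_content) outer_content"
    by (rule Pow.caratheodory_lemma[OF outer_measure_space_outer_content])
  then interpret lambda: sigma_algebra "topspace T"
    "lambda_system (topspace T) (Pow (topspace T)) outer_content"
    by (simp add: measure_space_def)
  have "sigma_sets (topspace T) {U. openin T U} \<subseteq>
      lambda_system (topspace T) (Pow (topspace T)) outer_content"
    using openin_lambda_system by (intro lambda.sigma_sets_subset) auto
  moreover have "sigma_algebra (topspace T) (sigma_sets (topspace T) {U. openin T U})"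
    by (intro sigma_algebra_sigma_sets) (auto dest: openin_subset)
  ultimately have "measure_space (topspace T) (sigma_sets (topspace T) {U. openin T U}) outer_content"
    using measure_down[OF ms] by blast
  then have "emeasure riesz_measure U = outer_content U"
    using assms by (intro emeasure_measure_of[OF riesz_measure_def])
      (auto simp: measure_space_def sets_riesz_measure sets_borel_of dest: openin_subset)
  then show ?thesis
    by (simp add: outer_content_open assms)
qed

lemma finite_riesz_measure: "finite_measure riesz_measure"
  by (rule finite_measureI) (simp add: space_riesz_measure emeasure_riesz_measure open_content_topspace)

sublocale riesz: finite_measure riesz_measure
  by (rule finite_riesz_measure)

lemma integrable_riesz_measure:
  "continuous_map T euclideanreal f \<Longrightarrow> integrable riesz_measure f"
  by (rule continuous_map_integrable[OF compact _ finite_riesz_measure sets_riesz_measure])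

lemma measure_riesz_measure_topspace: "measure riesz_measure (topspace T) = L (\<lambda>x. 1)"
  using emeasure_riesz_measure[OF openin_topspace] one_nonneg
  by (simp add: measure_def open_content_topspace)

section \<open>The functional as an integral\<close>

lemma functional_le_measure:
  assumes "openin T U" "f \<in> below U"
  shows "L f \<le> measure riesz_measure U"
proof -
  have "ennreal (L f) \<le> ennreal (measure riesz_measure U)"
    using le_open_content[OF assms(2)] emeasure_riesz_measure[OF assms(1)]
    by (simp add: riesz.emeasure_eq_measure)
  then show ?thesis by simp
qed

text \<open>
  Layer cake: \<open>N * f\<close> is the sum of the slices \<open>min 1 (max 0 (N * f - j))\<close>, and the \<open>j\<close>-th slice lies
  between the indicators of \<open>{x. j + 1 < N * f x}\<close> and \<open>{x. j < N * f x}\<close>.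
\<close>

lemma sum_slices:
  fixes y :: real
  assumes "0 \<le> y"
  shows "(\<Sum>j<m. min 1 (max 0 (y - real j))) = min (real m) y"
proof (induction m)
  case 0
  then show ?case using assms by simp
next
  case (Suc m)
  then show ?case using assms by (simp add: min_def max_def)
qed

text \<open>The value of \<open>L\<close> at slice \<open>j + 1\<close> is at most the measure of
  \<open>U (j + 1)\<close>, which is at most the integral of slice \<open>j\<close>. Only slice 0 is
  left over, at a cost of at most \<open>L 1\<close>. This fixed error disappears after division by
  \<open>N\<close>, for \<open>N\<close> large.\<close>

lemma functional_le_integral_unit:
  assumes f: "continuous_map T euclideanreal f"
    and f01: "\<And>x. x \<in> topspace T \<Longrightarrow> 0 \<le> f x \<and> f x \<le> 1"
  shows "L f \<le> (\<integral>x. f x \<partial>riesz_measure)"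
proof -
  have bound: "real N * L f \<le> L (\<lambda>x. 1) + real N * (\<integral>x. f x \<partial>riesz_measure)" if "0 < N" for N :: nat
  proof -
    define s where "s j x = min 1 (max 0 (real N * f x - real j))" for j x
    define U where "U j = {x \<in> topspace T. real N * f x \<in> {real j<..}}" for j
    have s: "continuous_map T euclideanreal (s j)" for j
      unfolding s_def using f by (intro continuous_intros continuous_map_real_mult_left) auto
    have U: "openin T (U j)" for j
      unfolding U_def using f
      by (intro openin_continuous_map_preimage[where Y=euclideanreal] continuous_map_real_mult_left) auto
    have sum_s: "(\<Sum>j<N. s j x) = real N * f x" if "x \<in> topspace T" for x
    proof -
      have "0 \<le> real N * f x" "real N * f x \<le> real N"
        using f01[OF that] by (auto simp: mult_left_le)
      then show ?thesis unfolding s_def by (subst sum_slices) auto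
    qed
    have s_nonneg: "0 \<le> s j x" for j x
      by (simp add: s_def)
    have Ls: "L (s j) \<le> measure riesz_measure (U j)" for j
      using s by (intro functional_le_measure U)
        (auto simp: below_def s_def U_def indicator_def)
    have Us: "measure riesz_measure (U (Suc j)) \<le> (\<integral>x. s j x \<partial>riesz_measure)" for j
    proof -
      have "U (Suc j) \<in> sets riesz_measure"
        using U by (auto simp: sets_riesz_measure sets_borel_of)
      then have "measure riesz_measure (U (Suc j)) = (\<integral>x. indicator (U (Suc j)) x \<partial>riesz_measure)"
        by simp
      also have "\<dots> \<le> (\<integral>x. s j x \<partial>riesz_measure)"
      proof (rule integral_mono[OF _ integrable_riesz_measure[OF s]])
        show "integrable riesz_measure (indicator (U (Suc j)) :: 'b \<Rightarrow> real)"
          using \<open>U (Suc j) \<in> sets riesz_measure\<close>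
          by (intro integrable_real_indicator) (simp_all add: riesz.emeasure_eq_measure)
        show "indicator (U (Suc j)) x \<le> s j x" for x
          using s_nonneg[of j x] by (auto simp: U_def s_def indicator_def)
      qed
      finally show ?thesis .
    qed
    have step: "(\<Sum>j<Suc m. L (s j)) \<le> L (\<lambda>x. 1) + (\<Sum>j<m. \<integral>x. s j x \<partial>riesz_measure)" for m
    proof (induction m)
      case 0
      have "L (s 0) \<le> L (\<lambda>x. 1)"
        by (intro mono s) (auto simp: s_def)
      then show ?case by simp
    next
      case (Suc m)
      then show ?case using Ls[of "Suc m"] Us[of m] by simp
    qed
    have "real N * L f = L (\<lambda>x. real N * f x)"
      using scale[OF f] by simp
    also have "\<dots> \<le> L (\<lambda>x. \<Sum>j<N. s j x)"
      using sum_s s f by (intro mono continuous_intros continuous_map_real_mult_left) auto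
    also have "\<dots> = (\<Sum>j<N. L (s j))"
      using s by (intro sum) auto
    \<comment> \<open>One more slice, with nonnegative value, is added so that after the shift by
      one the integrals of exactly the slices below \<open>N\<close> remain.\<close>
    also have "\<dots> \<le> (\<Sum>j<Suc N. L (s j))"
      using nonneg[OF s s_nonneg] by simp
    also have "\<dots> \<le> L (\<lambda>x. 1) + (\<Sum>j<N. \<integral>x. s j x \<partial>riesz_measure)"
      by (rule step)
    also have "(\<Sum>j<N. \<integral>x. s j x \<partial>riesz_measure) = (\<integral>x. (\<Sum>j<N. s j x) \<partial>riesz_measure)"
      using s by (intro Bochner_Integration.integral_sum[symmetric] integrable_riesz_measure)
    also have "\<dots> = (\<integral>x. real N * f x \<partial>riesz_measure)"
      using sum_s by (intro Bochner_Integration.integral_cong) (auto simp: space_riesz_measure)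
    finally show ?thesis by simp
  qed
  show ?thesis
  proof (rule ccontr)
    assume "\<not> ?thesis"
    then have "0 < L f - (\<integral>x. f x \<partial>riesz_measure)" by simp
    then obtain N where N: "L (\<lambda>x. 1) < real N * (L f - (\<integral>x. f x \<partial>riesz_measure))"
      using reals_Archimedean3 by blast
    moreover have "0 < N"
      using N one_nonneg by (cases N) auto
    ultimately show False
      using bound[of N] by (simp add: algebra_simps)
  qed
qed

text \<open>An affine change with \<open>a = 1 / (2 * B)\<close> brings the values into the unit
  interval. It acts alike on both sides because the total mass is \<open>L 1\<close>.\<close>

lemma functional_le_integral:
  assumes f: "continuous_map T euclideanreal f"
  shows "L f \<le> (\<integral>x. f x \<partial>riesz_measure)"
proof -
  obtain B where B: "0 < B" "\<And>x. x \<in> topspace T \<Longrightarrow> \<bar>f x\<bar> \<le> B"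
    using compact_space_continuous_map_bounded[OF compact f] by auto
  define a where "a = 1 / (2 * B)"
  have "0 < a"
    using B(1) by (simp add: a_def)
  define g where "g x = a * (f x + B)" for x
  have fB: "continuous_map T euclideanreal (\<lambda>x. f x + B)"
    using f by (intro continuous_intros) auto
  have "L g \<le> (\<integral>x. g x \<partial>riesz_measure)"
  proof (rule functional_le_integral_unit)
    show "continuous_map T euclideanreal g"
      unfolding g_def using fB by (rule continuous_map_real_mult_left)
    show "0 \<le> g x \<and> g x \<le> 1" if "x \<in> topspace T" for x
      using B(1) B(2)[OF that] by (auto simp: g_def a_def field_simps abs_le_iff)
  qed
  moreover have "L g = a * (L f + B * L (\<lambda>x. 1))"
    unfolding g_def using scale[OF fB, of a] add[OF f, of "\<lambda>x. B"] const[of B] by simp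
  moreover have "(\<integral>x. g x \<partial>riesz_measure) =
      a * ((\<integral>x. f x \<partial>riesz_measure) + B * L (\<lambda>x. 1))"
    unfolding g_def using integrable_riesz_measure[OF f]
    by (simp add: space_riesz_measure measure_riesz_measure_topspace)
  ultimately show ?thesis
    using \<open>0 < a\<close> by simp
qed

text \<open>The inequality applied to \<open>- f\<close> is the reverse inequality for
  \<open>f\<close>.\<close>

theorem integral_riesz_measure:
  assumes f: "continuous_map T euclideanreal f"
  shows "(\<integral>x. f x \<partial>riesz_measure) = L f"
proof (rule antisym)
  have "L (\<lambda>x. - 1 * f x) \<le> (\<integral>x. - 1 * f x \<partial>riesz_measure)"
    using f by (intro functional_le_integral continuous_map_real_mult_left)
  then show "(\<integral>x. f x \<partial>riesz_measure) \<le> L f"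
    using scale[OF f, of "- 1"] by simp
qed (rule functional_le_integral[OF f])

end

section \<open>Duality\<close>

text \<open>The duality for an abstract space \<open>G\<close> of continuous functions:
  \<open>\<nu>\<close> will be the optimal plan, and the last conclusion says that minorants of
  \<open>c\<close> in \<open>G\<close> come arbitrarily close to its cost. Since \<open>p\<close> is
  built from majorants, the functional is extended from \<open>- c\<close>.\<close>

lemma positive_extension_duality:
  fixes T :: "'b topology" and G :: "('b \<Rightarrow> real) set"
  assumes T: "compact_space T" "metrizable_space T"
    and \<pi>: "prob_space \<pi>" "sets \<pi> = sets (borel_of T)"
    and G_cont: "\<And>g. g \<in> G \<Longrightarrow> continuous_map T euclideanreal g"
    and G_add: "\<And>f g. f \<in> G \<Longrightarrow> g \<in> G \<Longrightarrow> (\<lambda>x. f x + g x) \<in> G"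
    and G_scale: "\<And>g a. g \<in> G \<Longrightarrow> (\<lambda>x. a * g x) \<in> G"
    and G_const: "\<And>a. (\<lambda>x. a) \<in> G"
    and c: "continuous_map T euclideanreal c"
  obtains \<nu> where "prob_space \<nu>" "sets \<nu> = sets (borel_of T)"
    "\<And>g. g \<in> G \<Longrightarrow> (\<integral>x. g x \<partial>\<nu>) = (\<integral>x. g x \<partial>\<pi>)"
    "\<And>e. 0 < e \<Longrightarrow> \<exists>g\<in>G. (\<forall>x\<in>topspace T. g x \<le> c x) \<and> (\<integral>x. c x \<partial>\<nu>) - e < (\<integral>x. g x \<partial>\<pi>)"
proof -
  interpret \<pi>: prob_space \<pi> by fact
  have space_\<pi>: "space \<pi> = topspace T"
    using sets_eq_imp_space_eq[OF \<pi>(2)] by simp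
  have integrable_\<pi>: "integrable \<pi> f" if "continuous_map T euclideanreal f" for f
    using continuous_map_integrable[OF T(1) that \<pi>.finite_measure_axioms \<pi>(2)] .
  define E where "E = {f. continuous_map T euclideanreal f}"
  interpret function_space E
    by standard (auto simp: E_def intro: continuous_map_add continuous_map_real_mult_left)
  define D where "D h = {g \<in> G. \<forall>x\<in>topspace T. h x \<le> g x}" for h
  define p where "p h = (INF g\<in>D h. \<integral>x. g x \<partial>\<pi>)" for h
  \<comment> \<open>Here the existence of \<open>\<pi>\<close> matters: the integral of
    \<open>h\<close> against it bounds the infimum from below.\<close>
  have bdd: "bdd_below ((\<lambda>g. \<integral>x. g x \<partial>\<pi>) ` D h)" if "h \<in> E" for h
    using that G_cont
    by (intro bdd_belowI2[of _ "\<integral>x. h x \<partial>\<pi>"] integral_mono integrable_\<pi>)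
      (auto simp: D_def E_def space_\<pi>)
  \<comment> \<open>By compactness \<open>h\<close> is bounded, so a constant lies above it.\<close>
  have D_nonempty: "D h \<noteq> {}" if h: "h \<in> E" for h
  proof -
    obtain B where "\<forall>x\<in>topspace T. \<bar>h x\<bar> \<le> B"
      using compact_space_continuous_map_bounded[OF T(1)] h by (auto simp: E_def)
    then have "(\<lambda>x. B) \<in> D h"
      using G_const by (force simp: D_def)
    then show ?thesis by blast
  qed
  have p_le: "p h \<le> (\<integral>x. g x \<partial>\<pi>)" if "h \<in> E" "g \<in> D h" for g h
    unfolding p_def using bdd that by (intro cINF_lower)
  have p_ge: "a \<le> p h" if "h \<in> E" "\<And>g. g \<in> D h \<Longrightarrow> a \<le> (\<integral>x. g x \<partial>\<pi>)" for a h
    unfolding p_def using D_nonempty that by (intro cINF_greatest)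
  have sub: "sublinear_on E p"
    unfolding sublinear_on_def
  proof (intro conjI ballI allI impI)
    fix f g assume f: "f \<in> E" and g: "g \<in> E"
    have *: "p (\<lambda>x. f x + g x) \<le> (\<integral>x. f' x \<partial>\<pi>) + (\<integral>x. g' x \<partial>\<pi>)" if "f' \<in> D f" "g' \<in> D g" for f' g'
    proof -
      have "(\<lambda>x. f' x + g' x) \<in> D (\<lambda>x. f x + g x)"
        using that G_add by (auto simp: D_def intro: add_mono)
      then have "p (\<lambda>x. f x + g x) \<le> (\<integral>x. f' x + g' x \<partial>\<pi>)"
        by (rule p_le[OF add_closed[OF f g]])
      then show ?thesis
        using that G_cont by (simp add: integrable_\<pi> D_def)
    qed
    have "p (\<lambda>x. f x + g x) - (\<integral>x. g' x \<partial>\<pi>) \<le> p f" if "g' \<in> D g" for g'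
      using *[OF _ that] by (intro p_ge[OF f]) (simp add: algebra_simps)
    then have "p (\<lambda>x. f x + g x) - p f \<le> p g"
      by (intro p_ge[OF g]) (simp add: algebra_simps)
    then show "p (\<lambda>x. f x + g x) \<le> p f + p g" by simp
  next
    fix f and a :: real assume f: "f \<in> E" and a: "0 < a"
    have "p (\<lambda>x. a * f x) / a \<le> (\<integral>x. g x \<partial>\<pi>)" if "g \<in> D f" for g
    proof -
      have "(\<lambda>x. a * g x) \<in> D (\<lambda>x. a * f x)"
        using that G_scale a by (auto simp: D_def)
      then have "p (\<lambda>x. a * f x) \<le> (\<integral>x. a * g x \<partial>\<pi>)"
        by (rule p_le[OF scale_closed[OF f]])
      then show ?thesis
        using a by (simp add: field_simps)
    qed
    then have "p (\<lambda>x. a * f x) / a \<le> p f"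
      by (rule p_ge[OF f])
    then show "p (\<lambda>x. a * f x) \<le> a * p f"
      using a by (simp add: field_simps)
  qed
  have c': "(\<lambda>x. - c x) \<in> E"
    using c by (simp add: E_def)
  obtain L where "\<forall>f\<in>E. \<forall>g\<in>E. L (\<lambda>x. f x + g x) = L f + L g"
    "\<forall>f\<in>E. \<forall>a. L (\<lambda>x. a * f x) = a * L f" "\<forall>f\<in>E. L f \<le> p f"
    and L_c: "L (\<lambda>x. - c x) = p (\<lambda>x. - c x)"
    using Hahn_Banach_dominated[OF sub c'] by blast
  note L_add = this(1)[rule_format] and L_scale = this(2)[rule_format] and L_le = this(3)[rule_format]
  interpret L: positive_functional T L
  proof
    \<comment> \<open>For \<open>f \<ge> 0\<close> the zero function is a majorant of
      \<open>- f\<close> in \<open>G\<close>, so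
      \<open>L (- f) \<le> p (- f) \<le> 0\<close>.\<close>
    show "0 \<le> L f" if "continuous_map T euclideanreal f" "\<And>x. x \<in> topspace T \<Longrightarrow> 0 \<le> f x" for f
    proof -
      have f: "f \<in> E" using that by (simp add: E_def)
      have "(\<lambda>x. 0) \<in> D (\<lambda>x. - f x)"
        using G_const that by (auto simp: D_def)
      then have "L (\<lambda>x. - f x) \<le> 0"
        using p_le[OF uminus_closed[OF f]] L_le[OF uminus_closed[OF f]] by fastforce
      then show ?thesis
        using L_scale[OF f, of "- 1"] by simp
    qed
  qed (use T L_add L_scale in \<open>auto simp: E_def\<close>)
  let ?\<nu> = L.riesz_measure
  have L_G: "L g = (\<integral>x. g x \<partial>\<pi>)" if g: "g \<in> G" for g
  proof (rule antisym)
    \<comment> \<open>A member of \<open>G\<close> is its own majorant. Using this for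
      \<open>g\<close> and for \<open>- g\<close> gives equality.\<close>
    have le: "L h \<le> (\<integral>x. h x \<partial>\<pi>)" if "h \<in> G" for h
    proof -
      have "h \<in> E" "h \<in> D h" using that G_cont by (auto simp: D_def E_def)
      then show ?thesis using L_le p_le by (meson order_trans)
    qed
    show "L g \<le> (\<integral>x. g x \<partial>\<pi>)" by (rule le[OF g])
    show "(\<integral>x. g x \<partial>\<pi>) \<le> L g"
      using le[OF G_scale[OF g, of "- 1"]] L_scale[of g "- 1"] G_cont[OF g] by (simp add: E_def)
  qed
  have "measure ?\<nu> (space ?\<nu>) = 1"
    using L_G[OF G_const, of 1]
    by (simp add: L.space_riesz_measure L.measure_riesz_measure_topspace \<pi>.prob_space)
  then have "prob_space ?\<nu>"
    by (intro prob_spaceI) (simp add: L.riesz.emeasure_eq_measure)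
  moreover have "\<exists>g\<in>G. (\<forall>x\<in>topspace T. g x \<le> c x) \<and> (\<integral>x. c x \<partial>?\<nu>) - e < (\<integral>x. g x \<partial>\<pi>)"
    if e: "0 < e" for e
  proof -
    have "(\<integral>x. c x \<partial>?\<nu>) = - p (\<lambda>x. - c x)"
      using L.integral_riesz_measure[OF c] L_c L_scale[of c "- 1"] c by (simp add: E_def)
    \<comment> \<open>A nearly optimal majorant of \<open>- c\<close>; its negative is the desired
      minorant of \<open>c\<close>.\<close>
    moreover have "\<exists>g\<in>D (\<lambda>x. - c x). (\<integral>x. g x \<partial>\<pi>) < p (\<lambda>x. - c x) + e"
      using e cINF_less_iff[OF D_nonempty[OF c'] bdd[OF c'], of "p (\<lambda>x. - c x) + e"]
      unfolding p_def by simp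
    ultimately obtain g where g: "g \<in> G" "\<forall>x\<in>topspace T. - c x \<le> g x"
      "(\<integral>x. g x \<partial>\<pi>) < e - (\<integral>x. c x \<partial>?\<nu>)"
      by (auto simp: D_def)
    then show ?thesis
      using G_scale[OF g(1), of "- 1"] by (intro bexI[of _ "\<lambda>x. - 1 * g x"]) auto
  qed
  ultimately show ?thesis
    using that[of ?\<nu>] L.sets_riesz_measure L.integral_riesz_measure G_cont L_G by auto
qed

section \<open>Product spaces, tuples and projections\<close>

lemma metrizable_space_mtopology_of: "metrizable_space (mtopology_of m)"
  unfolding mtopology_of_def by (rule Metric_space.metrizable_space_mtopology) simp

lemma finite_increasing_tuples: "finite (increasing_tuples n k)"
  by (rule finite_subset[OF _ finite_lists_length_eq[of "{1..n}" k]])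
    (auto simp: increasing_tuples_def)

text \<open>The witness is the tuple of the first \<open>k\<close> indices. Some tuple must exist
  for a constant to be a sum of functions of \<open>k\<close> coordinates.\<close>

lemma increasing_tuples_nonempty: "k \<le> n \<Longrightarrow> increasing_tuples n k \<noteq> {}"
  using sorted_wrt_upt[of 1 "Suc k"]
  by (auto simp: increasing_tuples_def simp del: upt_Suc intro!: exI[of _ "[1..<Suc k]"])

lemma metrizable_space_full_product: "metrizable_space (full_product n X)"
  unfolding full_product_def metrizable_space_product_topology
  by (auto simp: metrizable_space_mtopology_of intro: countable_finite)

lemma metrizable_space_partial_product: "metrizable_space (partial_product X i)"
  unfolding partial_product_def metrizable_space_product_topology
  by (auto simp: metrizable_space_mtopology_of intro: countable_finite)

lemma continuous_map_tuple_proj: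
  assumes "i \<in> increasing_tuples n k"
  shows "continuous_map (full_product n X) (partial_product X i) (tuple_proj i)"
  unfolding partial_product_def continuous_map_componentwise
proof (intro conjI ballI)
  show "tuple_proj i ` topspace (full_product n X) \<subseteq> extensional {..<length i}"
    by (auto simp: tuple_proj_def)
  fix j assume "j \<in> {..<length i}"
  moreover from this have "i ! j \<in> {1..n}"
    using assms nth_mem by (fastforce simp: increasing_tuples_def)
  ultimately show "continuous_map (full_product n X) (mtopology_of (X (i ! j))) (\<lambda>x. tuple_proj i x j)"
    using continuous_map_product_projection[of "i ! j" "{1..n}" "\<lambda>l. mtopology_of (X l)"]
    by (simp add: tuple_proj_def full_product_def)
qed

theorem theorem3p2:
  fixes n k :: nat
    and X :: "nat \<Rightarrow> 'a metric"
    and c :: "(nat \<Rightarrow> 'a) \<Rightarrow> real"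
    and \<mu> :: "nat list \<Rightarrow> (nat \<Rightarrow> 'a) measure"
  assumes "1 \<le> k" and "k < n"
    and "\<And>l. l \<in> {1..n} \<Longrightarrow> compact_space (mtopology_of (X l))"
    and "continuous_map (full_product n X) euclideanreal c"
    and "\<And>x. x \<in> topspace (full_product n X) \<Longrightarrow> 0 \<le> c x"
    and "\<And>i. i \<in> increasing_tuples n k \<Longrightarrow>
          \<mu> i \<in> borel_probability_measures (partial_product X i)"
    and "transport_plans n k X \<mu> \<noteq> {}"
  shows "\<exists>\<pi>\<^sub>0. is_arg_min (\<lambda>\<pi>. \<integral>x. c x \<partial>\<pi>) (\<lambda>\<pi>. \<pi> \<in> transport_plans n k X \<mu>) \<pi>\<^sub>0 \<and>
    ereal (\<integral>x. c x \<partial>\<pi>\<^sub>0) =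
      (SUP f\<in>dual_admissible n k X \<mu> c.
        ereal (\<Sum>i\<in>increasing_tuples n k. \<integral>y. f i y \<partial>\<mu> i))"
proof -
  define T where "T = full_product n X"
  define J where "J = increasing_tuples n k"
  define value_of where "value_of f = (\<Sum>i\<in>J. \<integral>y. f i y \<partial>\<mu> i)" for f :: "nat list \<Rightarrow> (nat \<Rightarrow> 'a) \<Rightarrow> real"
  define lift where "lift f x = (\<Sum>i\<in>J. f i (tuple_proj i x))" for f :: "nat list \<Rightarrow> (nat \<Rightarrow> 'a) \<Rightarrow> real" and x
  \<comment> \<open>Only continuous families enter \<open>G\<close>. They already approach the
    optimal cost, while weak duality covers all integrable families.\<close>
  define G where "G = {lift f |f. \<forall>i\<in>J. continuous_map (partial_product X i) euclideanreal (f i)}"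
  have J: "finite J" "J \<noteq> {}"
    using finite_increasing_tuples increasing_tuples_nonempty[of k n] assms(2) by (auto simp: J_def)
  have compact_T: "compact_space T"
    using assms(3) by (simp add: T_def full_product_def compact_space_product_topology)
  have compact_partial: "compact_space (partial_product X i)" if "i \<in> J" for i
  proof -
    have "i ! j \<in> {1..n}" if "j < length i" for j
      using \<open>i \<in> J\<close> nth_mem[OF that] by (auto simp: J_def increasing_tuples_def)
    then show ?thesis
      using assms(3) by (simp add: partial_product_def compact_space_product_topology)
  qed
  have cont_proj: "continuous_map T (partial_product X i) (tuple_proj i)" if "i \<in> J" for i
    using continuous_map_tuple_proj that by (simp add: T_def J_def)
  have \<mu>: "prob_space (\<mu> i)" "sets (\<mu> i) = sets (borel_of (partial_product X i))" if "i \<in> J" for i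
    using assms(6) that by (auto simp: J_def borel_probability_measures_def)
  have plan: "prob_space \<pi>" "sets \<pi> = sets (borel_of T)"
    "i \<in> J \<Longrightarrow> \<mu> i = distr \<pi> (borel_of (partial_product X i)) (tuple_proj i)"
    if "\<pi> \<in> transport_plans n k X \<mu>" for \<pi> i
    using that by (auto simp: transport_plans_def borel_probability_measures_def T_def J_def push_forward_def)
  have proj_measurable: "tuple_proj i \<in> \<pi> \<rightarrow>\<^sub>M borel_of (partial_product X i)"
    if "sets \<pi> = sets (borel_of T)" "i \<in> J" for \<pi> i
    using continuous_map_measurable[OF cont_proj[OF that(2)]] that(1) by (simp cong: measurable_cong_sets)
  \<comment> \<open>Change of variables along each projection: only the marginals matter, so the
    result is the same for every plan.\<close>
  have integral_lift: "integrable \<pi> (lift f) \<and> (\<integral>x. lift f x \<partial>\<pi>) = value_of f"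
    if \<pi>: "\<pi> \<in> transport_plans n k X \<mu>" and f: "\<And>i. i \<in> J \<Longrightarrow> integrable (\<mu> i) (f i)" for \<pi> f
  proof -
    have f_meas: "f i \<in> borel_measurable (borel_of (partial_product X i))" if "i \<in> J" for i
      using borel_measurable_integrable[OF f[OF that]] \<mu>(2)[OF that] by (simp cong: measurable_cong_sets)
    have int: "integrable \<pi> (\<lambda>x. f i (tuple_proj i x))" if "i \<in> J" for i
      using f[OF that] integrable_distr_eq[OF proj_measurable[OF plan(2)[OF \<pi>] that] f_meas[OF that]]
      by (simp add: plan(3)[OF \<pi> that, symmetric])
    have "(\<integral>x. f i (tuple_proj i x) \<partial>\<pi>) = (\<integral>y. f i y \<partial>\<mu> i)" if "i \<in> J" for i
      using integral_distr[OF proj_measurable[OF plan(2)[OF \<pi>] that] f_meas[OF that]]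
      by (simp add: plan(3)[OF \<pi> that, symmetric])
    then show ?thesis
      using int by (simp add: lift_def[abs_def] value_of_def)
  qed
  have weak: "value_of f \<le> (\<integral>x. c x \<partial>\<pi>)"
    if \<pi>: "\<pi> \<in> transport_plans n k X \<mu>" and f: "f \<in> dual_admissible n k X \<mu> c" for \<pi> f
  proof -
    have "integrable \<pi> c"
      using continuous_map_integrable[OF compact_T _ _ plan(2)[OF \<pi>]] assms(4) plan(1)[OF \<pi>]
      by (simp add: T_def prob_space.finite_measure)
    moreover have "space \<pi> = topspace T"
      using sets_eq_imp_space_eq[OF plan(2)[OF \<pi>]] by simp
    moreover have "lift f x \<le> c x" if "x \<in> topspace T" for x
      using f that by (simp add: dual_admissible_def lift_def J_def T_def)
    ultimately show ?thesis
      using integral_lift[OF \<pi>, of f] f integral_mono[of \<pi> "lift f" c]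
      by (simp add: dual_admissible_def J_def)
  qed
  have integrable_\<mu>: "integrable (\<mu> i) g"
    if "i \<in> J" "continuous_map (partial_product X i) euclideanreal g" for i g
    using continuous_map_integrable[OF compact_partial that(2)] \<mu> that(1)
    by (simp add: prob_space.finite_measure)
  obtain \<pi> where \<pi>: "\<pi> \<in> transport_plans n k X \<mu>"
    using assms(7) by blast
  have lift_cont: "continuous_map T euclideanreal (\<lambda>x. f (tuple_proj i x))"
    if "i \<in> J" "continuous_map (partial_product X i) euclideanreal f" for i f
    using continuous_map_compose[OF cont_proj[OF that(1)] that(2)] by (simp add: o_def)
  \<comment> \<open>The family is zero except at \<open>i\<close>. Such lifts provide the constants
    and later test the single marginals.\<close>
  have lift_in_G: "(\<lambda>x. f (tuple_proj i x)) \<in> G"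
    if "i \<in> J" "continuous_map (partial_product X i) euclideanreal f" for i f
  proof -
    have "lift (\<lambda>j y. if j = i then f y else 0) = (\<lambda>x. f (tuple_proj i x))"
      using J(1) that(1) by (simp add: lift_def[abs_def] sum.delta)
    then show ?thesis
      unfolding G_def using that by (auto intro!: exI[of _ "\<lambda>j y. if j = i then f y else 0"])
  qed
  obtain \<pi>\<^sub>0 where \<pi>\<^sub>0: "prob_space \<pi>\<^sub>0" "sets \<pi>\<^sub>0 = sets (borel_of T)"
    and eq: "\<And>g. g \<in> G \<Longrightarrow> (\<integral>x. g x \<partial>\<pi>\<^sub>0) = (\<integral>x. g x \<partial>\<pi>)"
    and approx: "\<And>e. 0 < e \<Longrightarrow> \<exists>g\<in>G. (\<forall>x\<in>topspace T. g x \<le> c x) \<and>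
      (\<integral>x. c x \<partial>\<pi>\<^sub>0) - e < (\<integral>x. g x \<partial>\<pi>)"
  proof (rule positive_extension_duality[of T \<pi> G c])
    show "prob_space \<pi>" "sets \<pi> = sets (borel_of T)"
      using plan[OF \<pi>] by auto
    show "metrizable_space T"
      by (simp add: T_def metrizable_space_full_product)
    show "continuous_map T euclideanreal c"
      using assms(4) by (simp add: T_def)
    show "continuous_map T euclideanreal g" if "g \<in> G" for g
      using that J(1) lift_cont by (auto simp: G_def lift_def[abs_def] intro!: continuous_map_sum)
    show "(\<lambda>x. g x + h x) \<in> G" if "g \<in> G" "h \<in> G" for g h
    proof -
      obtain u v where "\<forall>i\<in>J. continuous_map (partial_product X i) euclideanreal (u i)" "g = lift u"
        "\<forall>i\<in>J. continuous_map (partial_product X i) euclideanreal (v i)" "h = lift v"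
        using \<open>g \<in> G\<close> \<open>h \<in> G\<close> by (auto simp: G_def)
      then show ?thesis
        unfolding G_def
        by (auto simp: lift_def[abs_def] sum.distrib intro!: exI[of _ "\<lambda>i y. u i y + v i y"] continuous_map_add)
    qed
    show "(\<lambda>x. a * g x) \<in> G" if "g \<in> G" for g a
    proof -
      obtain u where "\<forall>i\<in>J. continuous_map (partial_product X i) euclideanreal (u i)" "g = lift u"
        using \<open>g \<in> G\<close> by (auto simp: G_def)
      then show ?thesis
        unfolding G_def
        by (auto simp: lift_def[abs_def] sum_distrib_left intro!: exI[of _ "\<lambda>i y. a * u i y"] continuous_map_real_mult_left)
    qed
    show "(\<lambda>x. a) \<in> G" for a
      using J(2) lift_in_G[of _ "\<lambda>_. a"] by auto
  qed (auto simp: compact_T)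
  have plan\<^sub>0: "\<pi>\<^sub>0 \<in> transport_plans n k X \<mu>"
  proof -
    \<comment> \<open>A continuous function of the coordinates in \<open>i\<close> lifts into
      \<open>G\<close>, where \<open>\<pi>\<^sub>0\<close> and \<open>\<pi>\<close> have equal
      integrals; continuous functions determine the marginal.\<close>
    have "push_forward X i \<pi>\<^sub>0 = \<mu> i" if i: "i \<in> J" for i
    proof (rule measure_eqI_continuous_map[OF metrizable_space_partial_product[of X i]])
      have meas: "tuple_proj i \<in> \<pi>\<^sub>0 \<rightarrow>\<^sub>M borel_of (partial_product X i)"
        by (rule proj_measurable[OF \<pi>\<^sub>0(2) i])
      then show "finite_measure (push_forward X i \<pi>\<^sub>0)"
        unfolding push_forward_def using \<pi>\<^sub>0(1)
        by (intro finite_measure.finite_measure_distr prob_space.finite_measure)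
      show "finite_measure (\<mu> i)" "sets (\<mu> i) = sets (borel_of (partial_product X i))"
        using \<mu>[OF i] by (auto intro: prob_space.finite_measure)
      show "sets (push_forward X i \<pi>\<^sub>0) = sets (borel_of (partial_product X i))"
        by (simp add: push_forward_def)
      fix f assume f: "continuous_map (partial_product X i) euclideanreal f"
      have f_meas: "f \<in> borel_measurable (borel_of (partial_product X i))"
        using continuous_map_borel_measurable[OF refl f] .
      have "(\<integral>y. f y \<partial>push_forward X i \<pi>\<^sub>0) = (\<integral>x. f (tuple_proj i x) \<partial>\<pi>\<^sub>0)"
        unfolding push_forward_def by (rule integral_distr[OF meas f_meas])
      also have "\<dots> = (\<integral>x. f (tuple_proj i x) \<partial>\<pi>)"
        by (rule eq[OF lift_in_G[OF i f]])
      also have "\<dots> = (\<integral>y. f y \<partial>\<mu> i)"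
        unfolding plan(3)[OF \<pi> i]
        by (rule integral_distr[OF proj_measurable[OF plan(2)[OF \<pi>] i] f_meas, symmetric])
      finally show "(\<integral>y. f y \<partial>push_forward X i \<pi>\<^sub>0) = (\<integral>y. f y \<partial>\<mu> i)" .
    qed
    then show ?thesis
      using \<pi>\<^sub>0 by (simp add: transport_plans_def borel_probability_measures_def T_def J_def)
  qed
  have near: "\<exists>f\<in>dual_admissible n k X \<mu> c. (\<integral>x. c x \<partial>\<pi>\<^sub>0) - e < value_of f" if "0 < e" for e
  proof -
    obtain f where f: "\<forall>i\<in>J. continuous_map (partial_product X i) euclideanreal (f i)"
      "\<forall>x\<in>topspace T. lift f x \<le> c x" "(\<integral>x. c x \<partial>\<pi>\<^sub>0) - e < (\<integral>x. lift f x \<partial>\<pi>)"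
      using approx[OF \<open>0 < e\<close>] by (auto simp: G_def)
    then have "f \<in> dual_admissible n k X \<mu> c"
      using integrable_\<mu> by (auto simp: dual_admissible_def lift_def J_def T_def)
    moreover have "(\<integral>x. lift f x \<partial>\<pi>) = value_of f"
      using integral_lift[OF \<pi>] integrable_\<mu> f(1) by blast
    ultimately show ?thesis using f(3) by auto
  qed
  have "is_arg_min (\<lambda>\<pi>. \<integral>x. c x \<partial>\<pi>) (\<lambda>\<pi>. \<pi> \<in> transport_plans n k X \<mu>) \<pi>\<^sub>0"
  proof -
    \<comment> \<open>With the gap between the two costs as \<open>e\<close>, \<open>near\<close>
      gives an admissible family worth more than the cost of \<open>\<pi>'\<close>, against weak
      duality.\<close>
    have False if less: "(\<integral>x. c x \<partial>\<pi>') < (\<integral>x. c x \<partial>\<pi>\<^sub>0)" and \<pi>': "\<pi>' \<in> transport_plans n k X \<mu>" for \<pi>'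
      using near[of "(\<integral>x. c x \<partial>\<pi>\<^sub>0) - (\<integral>x. c x \<partial>\<pi>')"] less weak[OF \<pi>'] by force
    then show ?thesis
      using plan\<^sub>0 by (auto simp: is_arg_min_def)
  qed
  moreover have "ereal (\<integral>x. c x \<partial>\<pi>\<^sub>0) = (SUP f\<in>dual_admissible n k X \<mu> c. ereal (value_of f))"
  proof (rule antisym)
    show "ereal (\<integral>x. c x \<partial>\<pi>\<^sub>0) \<le> (SUP f\<in>dual_admissible n k X \<mu> c. ereal (value_of f))"
    proof (rule ereal_le_epsilon2)
      fix e :: real assume "0 < e"
      then obtain f where f: "f \<in> dual_admissible n k X \<mu> c" "(\<integral>x. c x \<partial>\<pi>\<^sub>0) - e < value_of f"
        using near by blast
      then have "ereal (\<integral>x. c x \<partial>\<pi>\<^sub>0) \<le> ereal (value_of f) + ereal e" by simp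
      also have "\<dots> \<le> (SUP f\<in>dual_admissible n k X \<mu> c. ereal (value_of f)) + ereal e"
        using f(1) by (intro add_right_mono SUP_upper)
      finally show "ereal (\<integral>x. c x \<partial>\<pi>\<^sub>0) \<le> (SUP f\<in>dual_admissible n k X \<mu> c. ereal (value_of f)) + ereal e" .
    qed
    show "(SUP f\<in>dual_admissible n k X \<mu> c. ereal (value_of f)) \<le> ereal (\<integral>x. c x \<partial>\<pi>\<^sub>0)"
      using weak[OF plan\<^sub>0] by (intro SUP_least) simp
  qed
  ultimately show ?thesis
    by (auto simp: value_of_def J_def)
qed

end
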